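(* In the satisfaction system of preference statements with hierarchical models, there exist (a choice of variables, domains and operator $\oplus$ and) non-trivial sets of stakeholder statements $\Phi_1,\ldots,\Phi_n\subseteq\mathcal{L}$ that admit at least two middle grounds which are not logically equivalent.
   Context: Let $V$ be a finite set of variables; each $v\in V$ has a finite domain $\underline{v}$ with more than one element; alternatives are elements $\alpha\in\underline{V}=\prod_{v\in V}\underline{v}$, with $\alpha(v)$ the value of $v$. Let $\oplus$ be a commutative, associative operator combining values of any nonempty set of variables, and assume a total order $\geq$ on the domains and on $\oplus$-combinations of values. A hierarchical model is a non-empty sequence $\pi=(Y_1,\ldots,Y_k)$ of non-empty (not necessarily disjoint) subsets of $V$. For alternatives $\alpha,\beta$: $\alpha\succeq_\pi\beta$ iff either $\bigoplus_{y\in Y_i}\alpha(y)=\bigoplus_{y\in Y_i}\beta(y)$ for all $i$, or there is $i$ with $\bigoplus_{y\in Y_i}\alpha(y)>\bigoplus_{y\in Y_i}\beta(y)$ and equality for all $j<i$; $\alpha\succ_\pi\beta$ iff the second condition holds. The language is $\mathcal{L}=\{\alpha\geq\beta\mid\alpha,\beta\in\underline{V}\}\cup\{\alpha>\beta\mid\alpha,\beta\in\underline{V}\}$, with $\pi\models\alpha\geq\beta$ iff $\alpha\succeq_\pi\beta$ and $\pi\models\alpha>\beta$ iff $\alpha\succ_\pi\beta$. For $\Phi\subseteq\mathcal{L}$: $\pi\models\Phi$ iff $\pi$ satisfies every element; $\Phi\models\Phi'$ iff every model of $\Phi$ is a model of $\Phi'$; $\Phi\equiv\Phi'$ iff mutual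 entailment; $\Phi$ is consistent if it has a model, falsifiable if some hierarchical model does not satisfy it, non-trivial if both. Given non-trivial $\Phi_1,\ldots,\Phi_n$, $\Phi\subseteq\mathcal{L}$ is a middle ground if: (P1) $\Phi$ non-trivial; (P2) if $\bigcup_i\Phi_i$ is consistent then $\Phi\equiv\bigcup_i\Phi_i$; (P3) for each $\phi\in\Phi$, each $i$ and each $\phi_i\in\Phi_i$ some model satisfies both $\phi$ and $\phi_i$; (P4) each $\phi\in\Phi$ is entailed by some $\Phi_i$; (P5) no $\Phi'\subseteq\mathcal{L}$ satisfying (P1)–(P4) has $\Phi'\models\Phi$ and $\Phi\not\models\Phi'$. *)

theory Defs
  imports Main "HOL-Library.FuncSet"
begin

text \<open>
  The type \<open>'d\<close> holds the values of all variables together with all their combinations under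
  \<open>\<oplus>\<close>. An alternative is an extensional function, so that equality of alternatives is equality
  on \<open>V\<close>.
\<close>

datatype 'a preference = Geq 'a 'a | Gt 'a 'a

locale hierarchical_preferences =
  abel_semigroup oplus + linorder leq less
  for oplus :: "'d \<Rightarrow> 'd \<Rightarrow> 'd" (infixl "\<oplus>" 70)
    and leq :: "'d \<Rightarrow> 'd \<Rightarrow> bool" (infix "\<preceq>" 50)
    and less :: "'d \<Rightarrow> 'd \<Rightarrow> bool" (infix "\<prec>" 50) +
  fixes V :: "'v set"
    and D :: "'v \<Rightarrow> 'd set"
  assumes finite_vars: "finite V"
    and finite_domain: "v \<in> V \<Longrightarrow> finite (D v)"
    and card_domain: "v \<in> V \<Longrightarrow> 1 < card (D v)"
begin

definition alternatives :: "('v \<Rightarrow> 'd) set" where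
  "alternatives = (\<Pi>\<^sub>E v\<in>V. D v)"

text \<open>
  There need not be a neutral element, so the fold starts from \<open>None\<close>; the result is meaningful
  for finite non-empty \<open>Y\<close> only, see \<open>combine_singleton\<close> and \<open>combine_insert\<close>.
\<close>

definition combine :: "('v \<Rightarrow> 'd) \<Rightarrow> 'v set \<Rightarrow> 'd" where
  "combine \<alpha> Y =
    the (Finite_Set.fold
      (\<lambda>y acc. Some (case acc of None \<Rightarrow> \<alpha> y | Some z \<Rightarrow> \<alpha> y \<oplus> z)) None Y)"

lemma comp_fun_commute_combine:
  "comp_fun_commute (\<lambda>y acc. Some (case acc of None \<Rightarrow> \<alpha> y | Some z \<Rightarrow> \<alpha> y \<oplus> z))"
  by standard (auto simp: fun_eq_iff commute left_commute split: option.split)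

lemma combine_singleton: "combine \<alpha> {y} = \<alpha> y"
proof -
  interpret comp_fun_commute "\<lambda>y acc. Some (case acc of None \<Rightarrow> \<alpha> y | Some z \<Rightarrow> \<alpha> y \<oplus> z)"
    by (rule comp_fun_commute_combine)
  show ?thesis by (simp add: combine_def)
qed

lemma combine_insert:
  assumes "finite Y" "Y \<noteq> {}" "y \<notin> Y"
  shows "combine \<alpha> (insert y Y) = \<alpha> y \<oplus> combine \<alpha> Y"
proof -
  interpret comp_fun_commute "\<lambda>y acc. Some (case acc of None \<Rightarrow> \<alpha> y | Some z \<Rightarrow> \<alpha> y \<oplus> z)"
    by (rule comp_fun_commute_combine)
  obtain x X where "Y = insert x X" "x \<notin> X" "finite X"
    using assms by (metis all_not_in_conv finite_insert mk_disjoint_insert)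
  then show ?thesis using assms by (simp add: combine_def)
qed

definition hierarchical_model :: "'v set list \<Rightarrow> bool" where
  "hierarchical_model \<pi> \<longleftrightarrow> \<pi> \<noteq> [] \<and> (\<forall>Y\<in>set \<pi>. Y \<noteq> {} \<and> Y \<subseteq> V)"

definition strictly_preferred :: "'v set list \<Rightarrow> ('v \<Rightarrow> 'd) \<Rightarrow> ('v \<Rightarrow> 'd) \<Rightarrow> bool" where
  "strictly_preferred \<pi> \<alpha> \<beta> \<longleftrightarrow>
    (\<exists>i<length \<pi>. combine \<beta> (\<pi> ! i) \<prec> combine \<alpha> (\<pi> ! i) \<and>
      (\<forall>j<i. combine \<alpha> (\<pi> ! j) = combine \<beta> (\<pi> ! j)))"

definition weakly_preferred :: "'v set list \<Rightarrow> ('v \<Rightarrow> 'd) \<Rightarrow> ('v \<Rightarrow> 'd) \<Rightarrow> bool" where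
  "weakly_preferred \<pi> \<alpha> \<beta> \<longleftrightarrow>
    (\<forall>i<length \<pi>. combine \<alpha> (\<pi> ! i) = combine \<beta> (\<pi> ! i)) \<or> strictly_preferred \<pi> \<alpha> \<beta>"

definition language :: "('v \<Rightarrow> 'd) preference set" where
  "language =
    {Geq \<alpha> \<beta> |\<alpha> \<beta>. \<alpha> \<in> alternatives \<and> \<beta> \<in> alternatives} \<union>
    {Gt \<alpha> \<beta> |\<alpha> \<beta>. \<alpha> \<in> alternatives \<and> \<beta> \<in> alternatives}"

fun satisfies :: "'v set list \<Rightarrow> ('v \<Rightarrow> 'd) preference \<Rightarrow> bool" where
  "satisfies \<pi> (Geq \<alpha> \<beta>) \<longleftrightarrow> weakly_preferred \<pi> \<alpha> \<beta>"
| "satisfies \<pi> (Gt \<alpha> \<beta>) \<longleftrightarrow> strictly_preferred \<pi> \<alpha> \<beta>"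

definition model_of :: "'v set list \<Rightarrow> ('v \<Rightarrow> 'd) preference set \<Rightarrow> bool" where
  "model_of \<pi> \<Phi> \<longleftrightarrow> hierarchical_model \<pi> \<and> (\<forall>\<phi>\<in>\<Phi>. satisfies \<pi> \<phi>)"

definition entails :: "('v \<Rightarrow> 'd) preference set \<Rightarrow> ('v \<Rightarrow> 'd) preference set \<Rightarrow> bool" where
  "entails \<Phi> \<Psi> \<longleftrightarrow> (\<forall>\<pi>. model_of \<pi> \<Phi> \<longrightarrow> model_of \<pi> \<Psi>)"

definition equivalent :: "('v \<Rightarrow> 'd) preference set \<Rightarrow> ('v \<Rightarrow> 'd) preference set \<Rightarrow> bool" where
  "equivalent \<Phi> \<Psi> \<longleftrightarrow> entails \<Phi> \<Psi> \<and> entails \<Psi> \<Phi>"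

definition consistent :: "('v \<Rightarrow> 'd) preference set \<Rightarrow> bool" where
  "consistent \<Phi> \<longleftrightarrow> (\<exists>\<pi>. model_of \<pi> \<Phi>)"

definition falsifiable :: "('v \<Rightarrow> 'd) preference set \<Rightarrow> bool" where
  "falsifiable \<Phi> \<longleftrightarrow> (\<exists>\<pi>. hierarchical_model \<pi> \<and> \<not> model_of \<pi> \<Phi>)"

definition nontrivial :: "('v \<Rightarrow> 'd) preference set \<Rightarrow> bool" where
  "nontrivial \<Phi> \<longleftrightarrow> consistent \<Phi> \<and> falsifiable \<Phi>"

text \<open>
  The stakeholders are numbered \<open>1, \<dots>, n\<close>; values of \<open>\<Phi>s\<close> outside this range are irrelevant.
  A compromise meets every requirement on a middle ground other than logical maximality.
\<close>

definition compromise ::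
  "nat \<Rightarrow> (nat \<Rightarrow> ('v \<Rightarrow> 'd) preference set) \<Rightarrow> ('v \<Rightarrow> 'd) preference set \<Rightarrow> bool" where
  "compromise n \<Phi>s \<Phi> \<longleftrightarrow>
    \<Phi> \<subseteq> language \<and>
    nontrivial \<Phi> \<and>
    (consistent (\<Union>i\<in>{1..n}. \<Phi>s i) \<longrightarrow> equivalent \<Phi> (\<Union>i\<in>{1..n}. \<Phi>s i)) \<and>
    (\<forall>\<phi>\<in>\<Phi>. \<forall>i\<in>{1..n}. \<forall>\<psi>\<in>\<Phi>s i. \<exists>\<pi>. model_of \<pi> {\<phi>, \<psi>}) \<and>
    (\<forall>\<phi>\<in>\<Phi>. \<exists>i\<in>{1..n}. entails (\<Phi>s i) {\<phi>})"

definition middle_ground ::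
  "nat \<Rightarrow> (nat \<Rightarrow> ('v \<Rightarrow> 'd) preference set) \<Rightarrow> ('v \<Rightarrow> 'd) preference set \<Rightarrow> bool" where
  "middle_ground n \<Phi>s \<Phi> \<longleftrightarrow>
    compromise n \<Phi>s \<Phi> \<and>
    \<not> (\<exists>\<Phi>'. compromise n \<Phi>s \<Phi>' \<and> entails \<Phi>' \<Phi> \<and> \<not> entails \<Phi> \<Phi>')"

end

end

(* A strict preference cycle of length three is inconsistent by transitivity, but any two of its
   statements can hold together. Give each stakeholder one statement of the cycle. Then two
   different pairs of statements are compromises, and as the language is finite each of them is
   entailed by some middle ground. Equivalent middle grounds would entail the whole cycle. *)
theory Submission
  imports Defs
begin

context hierarchical_preferences
begin

lemma strictly_preferred_irrefl: "\<not> strictly_preferred \<pi> \<alpha> \<alpha>"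
  by (simp add: strictly_preferred_def)

lemma strictly_preferred_trans:
  assumes "strictly_preferred \<pi> \<alpha> \<beta>" "strictly_preferred \<pi> \<beta> \<gamma>"
  shows "strictly_preferred \<pi> \<alpha> \<gamma>"
proof -
  obtain i where i: "i < length \<pi>" "combine \<beta> (\<pi> ! i) \<prec> combine \<alpha> (\<pi> ! i)"
      "\<forall>j<i. combine \<alpha> (\<pi> ! j) = combine \<beta> (\<pi> ! j)"
    using assms(1) by (auto simp: strictly_preferred_def)
  obtain k where k: "k < length \<pi>" "combine \<gamma> (\<pi> ! k) \<prec> combine \<beta> (\<pi> ! k)"
      "\<forall>j<k. combine \<beta> (\<pi> ! j) = combine \<gamma> (\<pi> ! j)"
    using assms(2) by (auto simp: strictly_preferred_def)
  \<comment> \<open>\<open>m\<close> is the first level at which one of the two comparisons is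
    decided. Before it all three alternatives agree; at \<open>m\<close> one comparison is strict
    and the other is strict or an equality.\<close>
  define m where "m = ord_class.min i k"
  have "combine \<gamma> (\<pi> ! m) \<prec> combine \<alpha> (\<pi> ! m)"
    using i k less_trans by (cases i k rule: linorder_class.linorder_cases) (auto simp: m_def ord_class.min_def)
  moreover have "\<forall>j<m. combine \<alpha> (\<pi> ! j) = combine \<gamma> (\<pi> ! j)"
    using i(3) k(3) by (simp add: m_def)
  moreover have "m < length \<pi>" using i(1) by (simp add: m_def)
  ultimately show ?thesis by (auto simp: strictly_preferred_def)
qed

text \<open>Models with one level and one variable are the only ones that need to be exhibited
  later; for them preference is a comparison of two values.\<close>

lemma strictly_preferred_singleton:
  "strictly_preferred [{v}] \<alpha> \<beta> \<longleftrightarrow> \<beta> v \<prec> \<alpha> v"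
  by (simp add: strictly_preferred_def combine_singleton)

lemma finite_alternatives: "finite alternatives"
  unfolding alternatives_def by (intro finite_PiE finite_vars finite_domain)

lemma finite_language: "finite language"
proof -
  have "language =
      case_prod Geq ` (alternatives \<times> alternatives) \<union> case_prod Gt ` (alternatives \<times> alternatives)"
    by (auto simp: language_def)
  then show ?thesis by (simp add: finite_alternatives)
qed

lemma entails_refl: "entails \<Phi> \<Phi>"
  by (simp add: entails_def)

lemma entails_trans: "entails \<Phi> \<Psi> \<Longrightarrow> entails \<Psi> \<Theta> \<Longrightarrow> entails \<Phi> \<Theta>"
  by (simp add: entails_def)

lemma entails_if_entails_each: "\<Psi> \<noteq> {} \<Longrightarrow> \<forall>\<phi>\<in>\<Psi>. entails \<Phi> {\<phi>} \<Longrightarrow> entails \<Phi> \<Psi>"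
  by (auto simp: entails_def model_of_def)

lemma entails_subset: "entails \<Phi> \<Psi> \<Longrightarrow> \<Theta> \<subseteq> \<Psi> \<Longrightarrow> entails \<Phi> \<Theta>"
  by (auto simp: entails_def model_of_def)

text \<open>A finite language has only finitely many sets of consequences, so one of the compromises
  entailing \<open>\<Phi>\<close> has a maximal set of consequences.\<close>

lemma compromise_entailed_by_middle_ground:
  assumes "compromise n \<Phi>s \<Phi>"
  obtains \<Psi> where "middle_ground n \<Phi>s \<Psi>" "entails \<Psi> \<Phi>"
proof -
  \<comment> \<open>Consequences are compared instead of the sets themselves, because for subsets of
    the language inclusion of \<open>Th\<close> mirrors entailment.\<close>
  define Th where "Th \<Psi> = {\<phi> \<in> language. entails \<Psi> {\<phi>}}" for \<Psi>
  define C where "C = {\<Psi>. compromise n \<Phi>s \<Psi> \<and> entails \<Psi> \<Phi>}"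
  have "Th ` C \<subseteq> Pow language" by (auto simp: Th_def)
  then have "finite (Th ` C)" by (rule finite_subset) (simp add: finite_language)
  moreover have "\<Phi> \<in> C" using assms by (simp add: C_def entails_refl)
  ultimately obtain \<Psi> where \<Psi>: "\<Psi> \<in> C" "\<forall>\<Psi>'\<in>C. Th \<Psi> \<subseteq> Th \<Psi>' \<longrightarrow> Th \<Psi> = Th \<Psi>'"
    using order_class.finite_has_maximal[of "Th ` C"] by auto
  \<comment> \<open>A compromise entailing \<open>\<Psi>\<close> stays in \<open>C\<close> and has
    at least the consequences of \<open>\<Psi>\<close>. By maximality it has no others, so
    \<open>\<Psi>\<close> entails each of its statements.\<close>
  have "entails \<Psi> \<Psi>'" if \<Psi>': "compromise n \<Phi>s \<Psi>'" "entails \<Psi>' \<Psi>" for \<Psi>'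
  proof -
    have "\<Psi>' \<in> C" using \<Psi>(1) \<Psi>' entails_trans by (auto simp: C_def)
    moreover have "Th \<Psi> \<subseteq> Th \<Psi>'" using \<Psi>'(2) entails_trans by (auto simp: Th_def)
    ultimately have "Th \<Psi> = Th \<Psi>'" using \<Psi>(2) by blast
    moreover have "\<Psi>' \<subseteq> Th \<Psi>'"
      using \<Psi>'(1) by (auto simp: Th_def compromise_def entails_def model_of_def)
    ultimately have "\<forall>\<phi>\<in>\<Psi>'. entails \<Psi> {\<phi>}" by (auto simp: Th_def)
    \<comment> \<open>Every hierarchical model satisfies the empty set, so a falsifiable set has an
      element.\<close>
    moreover have "\<Psi>' \<noteq> {}"
      using \<Psi>'(1) by (auto simp: compromise_def nontrivial_def falsifiable_def model_of_def)
    ultimately show ?thesis by (intro entails_if_entails_each)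
  qed
  then have "middle_ground n \<Phi>s \<Psi>" using \<Psi>(1) by (auto simp: C_def middle_ground_def)
  then show thesis using \<Psi>(1) that by (simp add: C_def)
qed

end

theorem theorem6:
  "\<exists>(oplus :: nat \<Rightarrow> nat \<Rightarrow> nat) leq less (V :: nat set) D n \<Phi>s \<Phi> \<Phi>'.
    hierarchical_preferences oplus leq less V D \<and>
    1 \<le> n \<and>
    (\<forall>i\<in>{1..n}. \<Phi>s i \<subseteq> hierarchical_preferences.language V D \<and>
      hierarchical_preferences.nontrivial oplus less V (\<Phi>s i)) \<and>
    hierarchical_preferences.middle_ground oplus less V D n \<Phi>s \<Phi> \<and>
    hierarchical_preferences.middle_ground oplus less V D n \<Phi>s \<Phi>' \<and>
    \<not> hierarchical_preferences.equivalent oplus less V \<Phi> \<Phi>'"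
proof -
  define V where "V = {..<3::nat}"
  define D where "D = (\<lambda>v::nat. {..<3::nat})"
  interpret hierarchical_preferences "(+)" "(\<le>)" "(<)" V D
    by unfold_locales (auto simp: V_def D_def)
  \<comment> \<open>As in the Condorcet paradox, the three variables order \<open>f 1\<close>,
    \<open>f 2\<close>, \<open>f 3\<close> by the three cyclic shifts of one order.\<close>
  define f where "f k = (\<lambda>v\<in>V. (k + v) mod 3)" for k
  define \<phi> where "\<phi> i = Gt (f (Suc i)) (f i)" for i
  define \<Phi>s where "\<Phi>s i = {\<phi> i}" for i
  have in_V: "v \<in> V \<longleftrightarrow> v < 3" for v by (simp add: V_def)
  \<comment> \<open>This closes the cycle: \<open>\<phi> 3\<close> prefers \<open>f 1\<close> to
    \<open>f 3\<close>.\<close>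
  have cyclic: "f 4 = f 1" unfolding f_def by (intro restrict_ext) presburger
  have "f k \<in> alternatives" for k
    unfolding alternatives_def f_def by (simp add: D_def)
  then have language: "\<phi> i \<in> language" for i
    by (simp add: \<phi>_def language_def)
  have model: "hierarchical_model [{v}]" if "v < 3" for v
    using that by (simp add: hierarchical_model_def in_V)
  \<comment> \<open>Passing from \<open>f i\<close> to \<open>f (Suc i)\<close> raises the value of
    \<open>v\<close> by one, unless that value is 2 and wraps around to 0.\<close>
  have sat: "satisfies [{v}] (\<phi> i) \<longleftrightarrow> (i + v) mod 3 \<noteq> 2" if "v < 3" for i v
    using that by (simp add: \<phi>_def strictly_preferred_singleton f_def in_V mod_Suc)
  have pair: "consistent {\<phi> i, \<phi> j}" for i j
  proof -
    \<comment> \<open>Each statement fails at exactly one of the three variables, so two statements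
      leave a variable at which both hold.\<close>
    have "\<exists>v<3. (i + v) mod 3 \<noteq> 2 \<and> (j + v) mod 3 \<noteq> 2" by presburger
    then show ?thesis using model sat by (auto simp: consistent_def model_of_def)
  qed
  have false: "falsifiable \<Phi>" if "\<phi> i \<in> \<Phi>" for i \<Phi>
  proof -
    have "\<exists>v<3. (i + v) mod 3 = 2" by presburger
    then show ?thesis using model sat that unfolding falsifiable_def model_of_def by blast
  qed
  have range: "{1..3} = {1, 2, 3::nat}" by auto
  have cycle: "\<not> consistent \<Phi>" if "entails \<Phi> {\<phi> 1}" "entails \<Phi> {\<phi> 2}" "entails \<Phi> {\<phi> 3}" for \<Phi>
  proof
    assume "consistent \<Phi>"
    then obtain \<pi> where "model_of \<pi> \<Phi>" unfolding consistent_def by blast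
    then have "satisfies \<pi> (\<phi> 1)" "satisfies \<pi> (\<phi> 2)" "satisfies \<pi> (\<phi> 3)"
      using that by (simp_all add: entails_def model_of_def)
    moreover have "Suc 1 = 2" "Suc 2 = 3" "Suc 3 = 4" by simp_all
    ultimately have "strictly_preferred \<pi> (f 2) (f 1)" "strictly_preferred \<pi> (f 3) (f 2)"
        "strictly_preferred \<pi> (f 1) (f 3)"
      unfolding \<phi>_def satisfies.simps by (simp_all only: cyclic)
    then show False by (metis strictly_preferred_trans strictly_preferred_irrefl)
  qed
  \<comment> \<open>Inconsistency of the union makes the requirement of equivalence with it vacuous
    for every candidate.\<close>
  have "\<not> consistent (\<Union>i\<in>{1..3}. \<Phi>s i)"
    by (rule cycle) (auto simp: range \<Phi>s_def entails_def model_of_def)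
  then have compromise: "compromise 3 \<Phi>s {\<phi> i, \<phi> j}" if "i \<in> {1..3}" "j \<in> {1..3}" for i j
    unfolding compromise_def
  proof (intro conjI)
    show "{\<phi> i, \<phi> j} \<subseteq> language" using language by simp
    show "nontrivial {\<phi> i, \<phi> j}" using pair false[of i] by (simp add: nontrivial_def)
    show "\<forall>\<phi>\<in>{\<phi> i, \<phi> j}. \<forall>k\<in>{1..3}. \<forall>\<psi>\<in>\<Phi>s k. \<exists>\<pi>. model_of \<pi> {\<phi>, \<psi>}"
      using pair unfolding consistent_def \<Phi>s_def by blast
    show "\<forall>\<phi>\<in>{\<phi> i, \<phi> j}. \<exists>k\<in>{1..3}. entails (\<Phi>s k) {\<phi>}"
      using that entails_refl unfolding \<Phi>s_def by blast
  qed blast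
  obtain \<Psi> where \<Psi>: "middle_ground 3 \<Phi>s \<Psi>" "entails \<Psi> {\<phi> 1, \<phi> 2}"
    using compromise_entailed_by_middle_ground[OF compromise[of 1 2]] by auto
  obtain \<Psi>' where \<Psi>': "middle_ground 3 \<Phi>s \<Psi>'" "entails \<Psi>' {\<phi> 2, \<phi> 3}"
    using compromise_entailed_by_middle_ground[OF compromise[of 2 3]] by auto
  have "\<not> equivalent \<Psi> \<Psi>'"
  proof
    assume "equivalent \<Psi> \<Psi>'"
    then have "entails \<Psi> {\<phi> 2, \<phi> 3}" using \<Psi>'(2) entails_trans by (auto simp: equivalent_def)
    then have "\<not> consistent \<Psi>" using \<Psi>(2) by (intro cycle) (auto elim: entails_subset)
    then show False using \<Psi>(1) by (simp add: middle_ground_def compromise_def nontrivial_def)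
  qed
  \<comment> \<open>A single statement is the case \<open>i = j\<close> of
    \<open>pair\<close>.\<close>
  moreover have "\<forall>i\<in>{1..3}. \<Phi>s i \<subseteq> language \<and> nontrivial (\<Phi>s i)"
    using pair[of i i for i] language false by (auto simp: \<Phi>s_def nontrivial_def)
  moreover have "1 \<le> (3::nat)" by simp
  ultimately show ?thesis using \<Psi>(1) \<Psi>'(1) hierarchical_preferences_axioms by blast
qed

end
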